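(* Let $X,Y$ be real reflexive Banach spaces and let $Z$ be a real normed linear space, all of dimension strictly greater than one. Let $\mathcal{T}\in\mathscr{K}(X\times Y,Z)$ be weak-weak continuous. Then for any weak-weak continuous bilinear operator $\mathcal{A}\in\mathscr{K}(X\times Y,Z)$, $\mathcal{T}\perp_B\mathcal{A}$ if and only if there exist $(x,y),(u,v)\in M_{\mathcal{T}}$ such that $\mathcal{A}(x,y)\in(\mathcal{T}(x,y))^+$ and $\mathcal{A}(u,v)\in(\mathcal{T}(u,v))^-$.
   Context: $S_X$ denotes the unit sphere of $X$. $X\times Y$ carries the norm $\|(x,y)\|_\infty=\max\{\|x\|,\|y\|\}$. For a bilinear operator $\mathcal{T}:X\times Y\to Z$, $\|\mathcal{T}\|=\sup\{\|\mathcal{T}(x,y)\|:(x,y)\in S_X\times S_Y\}$, and $M_{\mathcal{T}}=\{(x,y)\in S_X\times S_Y:\|\mathcal{T}(x,y)\|=\|\mathcal{T}\|\}$. $\mathcal{T}$ is compact if for every bounded sequence $\{(x_n,y_n)\}\subset X\times Y$, the sequence $\{\mathcal{T}(x_n,y_n)\}$ has a convergent subsequence; $\mathscr{K}(X\times Y,Z)$ is the space of compact bilinear operators. Weak-weak continuous means continuous from $X\times Y$ with its weak topology to $Z$ with its weak topology. In a normed space, $x\perp_B y$ means $\|x+\lambda y\|\geq\|x\|$ for all $\lambda\in\mathbb{R}$ (for operators, with respect to the operator norm above); $x^+=\{y:\|x+\lambda y\|\geq\|x\|\ \forall\lambda\geq 0\}$ and $x^-=\{y:\|x+\lambda y\|\geq\|x\|\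 \forall\lambda\leq 0\}$. *)

theory Defs
  imports "HOL-Analysis.Analysis"
begin

text \<open>
  The canonical embedding into the bidual is onto.
\<close>

definition reflexive_space :: "'a::real_normed_vector itself \<Rightarrow> bool" where
  "reflexive_space _ \<longleftrightarrow>
     (\<forall>\<phi> :: ('a \<Rightarrow>\<^sub>L real) \<Rightarrow>\<^sub>L real. \<exists>x. \<forall>f.
        blinfun_apply \<phi> f = blinfun_apply f x)"

text \<open>
  The constant \<^const>\<open>dim\<close> is 0 on infinite-dimensional spaces, so dimension greater than one
  is expressed by two linearly independent vectors.
\<close>

definition dim_gt_one :: "'a::real_vector itself \<Rightarrow> bool" where
  "dim_gt_one _ \<longleftrightarrow> (\<exists>u v :: 'a. u \<noteq> v \<and> independent {u, v})"

text \<open>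
  The library norm on a product type is Euclidean; the norm wanted here is the maximum norm.
  The weak topology therefore takes the norm as a parameter: it is the coarsest topology making
  all linear functionals that are bounded with respect to \<open>N\<close> continuous.
\<close>

definition max_norm :: "'a::real_normed_vector \<times> 'b::real_normed_vector \<Rightarrow> real" where
  "max_norm p = max (norm (fst p)) (norm (snd p))"

definition weak_topology :: "('a::real_vector \<Rightarrow> real) \<Rightarrow> 'a topology" where
  "weak_topology N = topology_generated_by
     {f -` U | f U. linear f \<and> (\<exists>K. \<forall>x. \<bar>f x\<bar> \<le> K * N x) \<and> open (U :: real set)}"

definition weak_weak_continuous ::
  "('a::real_normed_vector \<Rightarrow> 'b::real_normed_vector \<Rightarrow> 'c::real_normed_vector) \<Rightarrow> bool" where
  "weak_weak_continuous T \<longleftrightarrow>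
     continuous_map (weak_topology max_norm) (weak_topology norm) (\<lambda>(x, y). T x y)"

definition compact_bilinear ::
  "('a::real_normed_vector \<Rightarrow> 'b::real_normed_vector \<Rightarrow> 'c::real_normed_vector) \<Rightarrow> bool" where
  "compact_bilinear T \<longleftrightarrow> bilinear T \<and>
     (\<forall>p :: nat \<Rightarrow> 'a \<times> 'b. (\<exists>B. \<forall>n. max_norm (p n) \<le> B) \<longrightarrow>
        (\<exists>l r. strict_mono (r :: nat \<Rightarrow> nat) \<and>
           (\<lambda>n. T (fst (p (r n))) (snd (p (r n)))) \<longlonglongrightarrow> l))"

text \<open>
  The supremum is taken in the reals, so it is meaningful only for bounded operators on
  nontrivial spaces. Compact bilinear operators, and their linear combinations, are bounded.
\<close>

definition bilin_norm ::
  "('a::real_normed_vector \<Rightarrow> 'b::real_normed_vector \<Rightarrow> 'c::real_normed_vector) \<Rightarrow> real" where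
  "bilin_norm T = (SUP (x, y) \<in> sphere 0 1 \<times> sphere 0 1. norm (T x y))"

definition norm_attainment ::
  "('a::real_normed_vector \<Rightarrow> 'b::real_normed_vector \<Rightarrow> 'c::real_normed_vector) \<Rightarrow> ('a \<times> 'b) set" where
  "norm_attainment T = {(x, y) \<in> sphere 0 1 \<times> sphere 0 1. norm (T x y) = bilin_norm T}"

definition bj_orthogonal ::
  "('a::real_normed_vector \<Rightarrow> 'b::real_normed_vector \<Rightarrow> 'c::real_normed_vector) \<Rightarrow>
   ('a \<Rightarrow> 'b \<Rightarrow> 'c) \<Rightarrow> bool" where
  "bj_orthogonal T A \<longleftrightarrow>
     (\<forall>t :: real. bilin_norm (\<lambda>x y. T x y + t *\<^sub>R A x y) \<ge> bilin_norm T)"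

definition bj_plus :: "'a::real_normed_vector \<Rightarrow> 'a set" where
  "bj_plus x = {y. \<forall>t\<ge>0. norm (x + t *\<^sub>R y) \<ge> norm x}"

definition bj_minus :: "'a::real_normed_vector \<Rightarrow> 'a set" where
  "bj_minus x = {y. \<forall>t\<le>0. norm (x + t *\<^sub>R y) \<ge> norm x}"

end

theory Submission
  imports Defs
begin

text \<open>
  If some \<open>(x, y)\<close> and \<open>(u, v)\<close> as on the right exist, then evaluating at
  \<open>(x, y)\<close> bounds the norm of \<open>T + t A\<close> from below for \<open>t \<ge> 0\<close>, and evaluating at \<open>(u, v)\<close>
  does so for \<open>t \<le> 0\<close>.

  For the converse, replacing \<open>A\<close> by \<open>- A\<close> leaves only the half-line \<open>t \<ge> 0\<close> to treat. Take unit
  vectors at which \<open>T + h A\<close> comes within \<open>h\<^sup>2\<close> of its norm, for \<open>h = 1, 1/2, 1/3, \<dots>\<close>. Since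
  \<open>t \<mapsto> \<parallel>T x y + t A x y\<parallel>\<close> is convex, at most \<open>\<parallel>T\<parallel>\<close> at \<open>0\<close>, and more than \<open>\<parallel>T\<parallel> - h\<^sup>2\<close> at \<open>h\<close>, it
  exceeds \<open>\<parallel>T\<parallel> - h t\<close> at every \<open>t \<ge> h\<close>. If the values of \<open>T\<close> and \<open>A\<close> at these vectors
  converge to \<open>T x y\<close> and \<open>A x y\<close>, then letting \<open>h\<close> tend to \<open>0\<close> shows
  \<open>\<parallel>T x y + t A x y\<parallel> \<ge> \<parallel>T\<parallel>\<close> for all \<open>t \<ge> 0\<close>, and \<open>t = 0\<close> shows that \<open>(x, y)\<close> attains the norm
  (\<open>one_sided_orthogonality_attained\<close>).

  Such a limit point exists (\<open>compact_pair_subsequence\<close>) because compactness of the operators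
  yields norm limits of the values along a subsequence, reflexivity yields a weak cluster point
  \<open>(x, y)\<close> of the arguments, and weak-weak continuity says that the values at \<open>(x, y)\<close> agree with
  the norm limits under every bounded functional. Bounded functionals separate points by the
  Hahn-Banach theorem. Weak cluster points are described by filters finer than the given one, so
  that Tychonoff's theorem takes the place of the Eberlein-Smulian theorem.
\<close>

section \<open>Norming functionals\<close>

definition sublinear :: "('a::real_vector \<Rightarrow> real) \<Rightarrow> bool" where
  "sublinear p \<longleftrightarrow>
     (\<forall>x y. p (x + y) \<le> p x + p y) \<and> (\<forall>c>0. \<forall>x. p (c *\<^sub>R x) \<le> c * p x)"

lemma sublinear_add: "sublinear p \<Longrightarrow> p (x + y) \<le> p x + p y"
  by (simp add: sublinear_def)

lemma sublinear_scale:
  assumes "sublinear p" "c > 0"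
  shows "p (c *\<^sub>R x) = c * p x"
proof (rule antisym)
  show "p (c *\<^sub>R x) \<le> c * p x" using assms by (simp add: sublinear_def)
  have "p ((1/c) *\<^sub>R (c *\<^sub>R x)) \<le> (1/c) * p (c *\<^sub>R x)"
    using assms unfolding sublinear_def by (metis zero_less_divide_1_iff)
  then show "c * p x \<le> p (c *\<^sub>R x)"
    using assms by (simp add: field_simps)
qed

lemma sublinear_zero: "sublinear p \<Longrightarrow> p 0 = 0"
  using sublinear_scale[of p 2 0] by simp

lemma sublinear_minus_lower: "sublinear p \<Longrightarrow> - p (- x) \<le> p x"
  using sublinear_add[of p x "- x"] sublinear_zero[of p] by simp

text \<open>
  The largest sublinear functional below \<open>p\<close> that takes the value \<open>- p y\<close> at \<open>- y\<close>. If \<open>p\<close> is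
  minimal, it is \<open>p\<close> itself, which forces \<open>p (- y) = - p y\<close>.
\<close>

definition directional :: "('a::real_vector \<Rightarrow> real) \<Rightarrow> 'a \<Rightarrow> 'a \<Rightarrow> real" where
  "directional p y x = (INF t\<in>{0..}. p (x + t *\<^sub>R y) - t * p y)"

lemma directional_le:
  assumes "sublinear p" "t \<ge> 0"
  shows "directional p y x \<le> p (x + t *\<^sub>R y) - t * p y"
  unfolding directional_def
proof (rule cINF_lower)
  show "bdd_below ((\<lambda>t. p (x + t *\<^sub>R y) - t * p y) ` {0..})"
  proof (rule bdd_belowI2)
    fix t :: real assume "t \<in> {0..}"
    then have "p (t *\<^sub>R y) = t * p y"
      using sublinear_scale[OF assms(1), of t y] sublinear_zero[OF assms(1)] by (cases "t = 0") auto
    then show "- p (- x) \<le> p (x + t *\<^sub>R y) - t * p y"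
      using sublinear_add[OF assms(1), of "x + t *\<^sub>R y" "- x"] by simp
  qed
qed (use assms in auto)

lemma directional_greatest:
  "(\<And>t. t \<ge> 0 \<Longrightarrow> b \<le> p (x + t *\<^sub>R y) - t * p y) \<Longrightarrow> b \<le> directional p y x"
  unfolding directional_def by (rule cINF_greatest) auto

lemma directional_le_self: "sublinear p \<Longrightarrow> directional p y x \<le> p x"
  using directional_le[of p 0 y x] by simp

lemma directional_minus: "sublinear p \<Longrightarrow> directional p y (- y) \<le> - p y"
  using directional_le[of p 1 y "- y"] sublinear_zero[of p] by simp

lemma sublinear_directional:
  assumes p: "sublinear p"
  shows "sublinear (directional p y)"
  unfolding sublinear_def
proof (intro conjI allI impI)
  fix x z
  have "directional p y (x + z) - (p (x + s *\<^sub>R y) - s * p y) \<le> directional p y z"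
    if "s \<ge> 0" for s
  proof (rule directional_greatest)
    fix t :: real assume "t \<ge> 0"
    have "directional p y (x + z) \<le> p (x + z + (s + t) *\<^sub>R y) - (s + t) * p y"
      using p that \<open>t \<ge> 0\<close> by (intro directional_le) auto
    moreover have "p (x + z + (s + t) *\<^sub>R y) \<le> p (x + s *\<^sub>R y) + p (z + t *\<^sub>R y)"
      using sublinear_add[OF p, of "x + s *\<^sub>R y" "z + t *\<^sub>R y"] by (simp add: algebra_simps)
    ultimately show "directional p y (x + z) - (p (x + s *\<^sub>R y) - s * p y)
        \<le> p (z + t *\<^sub>R y) - t * p y"
      by (simp add: algebra_simps)
  qed
  then have "directional p y (x + z) - directional p y z \<le> directional p y x"
    by (intro directional_greatest) (simp add: algebra_simps)
  then show "directional p y (x + z) \<le> directional p y x + directional p y z" by simp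
next
  fix c :: real and x assume "c > 0"
  have "directional p y (c *\<^sub>R x) / c \<le> directional p y x"
  proof (rule directional_greatest)
    fix t :: real assume "t \<ge> 0"
    have "directional p y (c *\<^sub>R x) \<le> p (c *\<^sub>R x + (c * t) *\<^sub>R y) - (c * t) * p y"
      using p \<open>t \<ge> 0\<close> \<open>c > 0\<close> by (intro directional_le) auto
    also have "p (c *\<^sub>R x + (c * t) *\<^sub>R y) = c * p (x + t *\<^sub>R y)"
      using sublinear_scale[OF p \<open>c > 0\<close>, of "x + t *\<^sub>R y"] by (simp add: scaleR_add_right)
    finally show "directional p y (c *\<^sub>R x) / c \<le> p (x + t *\<^sub>R y) - t * p y"
      using \<open>c > 0\<close> by (simp add: field_simps)
  qed
  then show "directional p y (c *\<^sub>R x) \<le> c * directional p y x"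
    using \<open>c > 0\<close> by (simp add: field_simps)
qed

text \<open>
  Sublinear functionals below \<open>p\<close> are bounded below pointwise by \<open>- p (- x)\<close>, so chains of them
  have infima, and Zorn's lemma gives a minimal one.
\<close>

lemma minimal_sublinear_exists:
  assumes p: "sublinear p"
  obtains m where "sublinear m" "m \<le> p" "\<And>q. sublinear q \<Longrightarrow> q \<le> m \<Longrightarrow> q = m"
proof -
  let ?S = "{q. sublinear q \<and> q \<le> p}"
  have "\<exists>m\<in>?S. \<forall>a\<in>?S. a \<le> m \<longrightarrow> a = m"
  proof (rule predicate_Zorn[where P = "\<lambda>a b. b \<le> a"])
    show "partial_order_on ?S (relation_of (\<lambda>a b. b \<le> a) ?S)"
      by (rule partial_order_on_relation_ofI) auto
  next
    fix C assume C: "C \<in> Chains (relation_of (\<lambda>a b. b \<le> a) ?S)"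
    then have CS: "C \<subseteq> ?S" by (auto simp: Chains_def relation_of_def)
    have ch: "a \<le> b \<or> b \<le> a" if "a \<in> C" "b \<in> C" for a b
      using C that by (auto simp: Chains_def relation_of_def)
    show "\<exists>u\<in>?S. \<forall>a\<in>C. u \<le> a"
    proof (cases "C = {}")
      case True
      then show ?thesis using p by auto
    next
      case False
      define u where "u x = (INF q\<in>C. q x)" for x
      have lower: "u x \<le> q x" if "q \<in> C" for q x
        unfolding u_def
      proof (rule cINF_lower)
        show "bdd_below ((\<lambda>q. q x) ` C)"
        proof (rule bdd_belowI2)
          fix q assume "q \<in> C"
          then have "sublinear q" "q (- x) \<le> p (- x)" using CS by (auto simp: le_fun_def)
          then show "- p (- x) \<le> q x" using sublinear_minus_lower[of q x] by linarith
        qed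
      qed (rule that)
      have greatest: "b \<le> u x" if "\<And>q. q \<in> C \<Longrightarrow> b \<le> q x" for b x
        unfolding u_def using False that by (rule cINF_greatest)
      have "sublinear u"
        unfolding sublinear_def
      proof (intro conjI allI impI)
        fix x y
        have "u (x + y) \<le> a x + b y" if "a \<in> C" "b \<in> C" for a b
        proof -
          have "\<exists>c\<in>C. c x \<le> a x \<and> c y \<le> b y"
            using ch[OF that] that unfolding le_fun_def by blast
          then obtain c where c: "c \<in> C" "c x \<le> a x" "c y \<le> b y"
            by blast
          then have "sublinear c" using CS by auto
          then show ?thesis
            using sublinear_add[of c x y] lower[OF c(1), of "x + y"] c by linarith
        qed
        then have "u (x + y) - a x \<le> b y" if "a \<in> C" "b \<in> C" for a b
          using that by (simp add: algebra_simps)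
        then have "u (x + y) - a x \<le> u y" if "a \<in> C" for a
          using that by (intro greatest)
        then have "u (x + y) - u y \<le> u x"
          by (intro greatest) (simp add: algebra_simps)
        then show "u (x + y) \<le> u x + u y" by simp
      next
        fix c :: real and x assume "c > 0"
        have "u (c *\<^sub>R x) / c \<le> u x"
        proof (rule greatest)
          fix q assume "q \<in> C"
          then have "q (c *\<^sub>R x) = c * q x" using CS \<open>c > 0\<close> by (auto intro: sublinear_scale)
          then show "u (c *\<^sub>R x) / c \<le> q x"
            using lower[OF \<open>q \<in> C\<close>, of "c *\<^sub>R x"] \<open>c > 0\<close> by (simp add: field_simps)
        qed
        then show "u (c *\<^sub>R x) \<le> c * u x" using \<open>c > 0\<close> by (simp add: field_simps)
      qed
      moreover have "u \<le> p"
      proof -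
        obtain q where "q \<in> C" using False by auto
        then have "u \<le> q" "q \<le> p" using lower CS by (auto simp: le_fun_def)
        then show ?thesis by simp
      qed
      ultimately show ?thesis using lower by (auto simp: le_fun_def)
    qed
  qed
  then obtain m where m: "m \<in> ?S" and min: "\<forall>a\<in>?S. a \<le> m \<longrightarrow> a = m" ..
  show thesis
  proof (rule that)
    show "sublinear m" "m \<le> p" using m by simp_all
    fix q assume q: "sublinear q" "q \<le> m"
    then have "q \<in> ?S" using m order_trans[of q m p] by simp
    then show "q = m" using min q(2) by simp
  qed
qed

text \<open>A form of the Hahn-Banach theorem: minimal sublinear functionals are odd, hence linear.\<close>

theorem linear_below_sublinear:
  assumes "sublinear p"
  obtains f where "linear f" "\<And>x. f x \<le> p x"
proof -
  obtain m where m: "sublinear m" "m \<le> p" and min: "\<And>q. sublinear q \<Longrightarrow> q \<le> m \<Longrightarrow> q = m"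
    using minimal_sublinear_exists[OF assms] by blast
  have odd: "m (- y) = - m y" for y
  proof -
    have "directional m y = m"
      by (rule min) (auto simp: le_fun_def m sublinear_directional directional_le_self)
    then have "m (- y) \<le> - m y" using directional_minus[OF m(1), of y] by simp
    then show ?thesis using sublinear_minus_lower[OF m(1), of y] by simp
  qed
  have "linear m"
  proof (rule linearI)
    fix x y
    show "m (x + y) = m x + m y"
      using sublinear_add[OF m(1), of x y] sublinear_add[OF m(1), of "x + y" "- y"] odd[of y] by simp
  next
    fix c :: real and x
    consider "c > 0" | "c = 0" | "- c > 0" by linarith
    then show "m (c *\<^sub>R x) = c *\<^sub>R m x"
    proof cases
      case 3
      then show ?thesis using sublinear_scale[OF m(1) 3, of x] odd[of "c *\<^sub>R x"] by simp
    qed (use m(1) sublinear_scale sublinear_zero in auto)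
  qed
  then show thesis using m(2) by (intro that) (auto simp: le_fun_def)
qed

text \<open>
  Starting from \<open>directional norm z\<close> instead of the norm forces the functional to be at most
  \<open>- norm z\<close> at \<open>- z\<close>.
\<close>

lemma norming_functional:
  fixes z :: "'a::real_normed_vector"
  obtains f :: "'a \<Rightarrow>\<^sub>L real" where "blinfun_apply f z = norm z" "\<And>x. \<bar>blinfun_apply f x\<bar> \<le> norm x"
proof -
  have norm: "sublinear (norm :: 'a \<Rightarrow> real)"
    by (auto simp: sublinear_def norm_triangle_ineq)
  obtain f where f: "linear f" "\<And>x. f x \<le> directional norm z x"
    using linear_below_sublinear[OF sublinear_directional[OF norm]] by blast
  have upper: "f x \<le> norm x" for x
    using f(2)[of x] directional_le_self[OF norm, of z x] by linarith
  have bound: "\<bar>f x\<bar> \<le> norm x" for x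
    using upper[of x] upper[of "- x"] linear_neg[OF f(1), of x] by simp
  have "f z = norm z"
    using f(2)[of "- z"] directional_minus[OF norm, of z] linear_neg[OF f(1), of z] upper[of z] by simp
  moreover have "bounded_linear f"
    using f(1) bound by (intro bounded_linear.intro bounded_linear_axioms.intro exI[of _ 1]) auto
  ultimately show thesis
    using bound by (intro that[of "Blinfun f"]) (auto simp: bounded_linear_Blinfun_apply)
qed

section \<open>Weak convergence along filters\<close>

lemma limitin_topology_generated_by:
  assumes "l \<in> \<Union>\<S>" and "\<And>S. S \<in> \<S> \<Longrightarrow> l \<in> S \<Longrightarrow> \<forall>\<^sub>F i in F. p i \<in> S"
  shows "limitin (topology_generated_by \<S>) p l F"
proof -
  have "l \<in> U \<longrightarrow> (\<forall>\<^sub>F i in F. p i \<in> U)" if "generate_topology_on \<S> U" for U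
    using that
  proof induction
    case (Int a b)
    then show ?case by (auto intro: eventually_conj)
  next
    case (UN K)
    show ?case
    proof
      assume "l \<in> \<Union> K"
      then obtain k where "k \<in> K" "\<forall>\<^sub>F i in F. p i \<in> k" using UN by blast
      then show "\<forall>\<^sub>F i in F. p i \<in> \<Union> K" by (auto elim: eventually_mono)
    qed
  qed (use assms in auto)
  then show ?thesis
    using assms(1) by (auto simp: limitin_def openin_topology_generated_by_iff)
qed

lemma limitin_weak_topology:
  "limitin (weak_topology N) p l F \<longleftrightarrow>
     (\<forall>f. linear f \<longrightarrow> (\<exists>K. \<forall>x. \<bar>f x\<bar> \<le> K * N x) \<longrightarrow> ((\<lambda>i. f (p i)) \<longlongrightarrow> f l) F)"
  (is "?L \<longleftrightarrow> ?R")
proof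
  assume L: ?L
  show ?R
  proof (intro allI impI topological_tendstoI)
    fix f :: "'a \<Rightarrow> real" and U
    assume f: "linear f" "\<exists>K. \<forall>x. \<bar>f x\<bar> \<le> K * N x" and U: "open U" "f l \<in> U"
    then have "openin (weak_topology N) (f -` U)"
      unfolding weak_topology_def by (intro topology_generated_by_Basis) blast
    then show "\<forall>\<^sub>F i in F. f (p i) \<in> U" using L U by (auto simp: limitin_def)
  qed
next
  assume R: ?R
  show ?L
    unfolding weak_topology_def
  proof (rule limitin_topology_generated_by)
    have "linear (\<lambda>x::'a. 0::real)" by (simp add: linear_iff)
    moreover have "\<exists>K. \<forall>x. \<bar>0::real\<bar> \<le> K * N x" by (auto intro: exI[of _ 0])
    ultimately show "l \<in> \<Union> {f -` U |f U. linear f \<and> (\<exists>K. \<forall>x. \<bar>f x\<bar> \<le> K * N x) \<and> open (U :: real set)}"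
      by (intro UnionI[of "(\<lambda>x::'a. 0::real) -` UNIV"] CollectI exI[of _ "\<lambda>x::'a. 0::real"] exI[of _ UNIV]) auto
  next
    fix S assume "S \<in> {f -` U |f U. linear f \<and> (\<exists>K. \<forall>x. \<bar>f x\<bar> \<le> K * N x) \<and> open (U :: real set)}"
      and "l \<in> S"
    then obtain f U where "S = f -` U" "linear f" "\<exists>K. \<forall>x. \<bar>f x\<bar> \<le> K * N x" "open U" "f l \<in> U"
      by blast
    then show "\<forall>\<^sub>F i in F. p i \<in> S"
      using R topological_tendstoD[of "\<lambda>i. f (p i)" "f l" F U] by simp
  qed
qed

text \<open>
  A functional on the product is the sum of its restrictions to the two axes, so weak
  convergence in each factor gives weak convergence of pairs.
\<close>

lemma limitin_weak_topology_max_norm: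
  fixes x :: "'i \<Rightarrow> 'a::real_normed_vector" and y :: "'i \<Rightarrow> 'b::real_normed_vector"
  assumes x: "\<And>f :: 'a \<Rightarrow>\<^sub>L real. ((\<lambda>i. blinfun_apply f (x i)) \<longlongrightarrow> blinfun_apply f a) F"
    and y: "\<And>f :: 'b \<Rightarrow>\<^sub>L real. ((\<lambda>i. blinfun_apply f (y i)) \<longlongrightarrow> blinfun_apply f b) F"
  shows "limitin (weak_topology max_norm) (\<lambda>i. (x i, y i)) (a, b) F"
  unfolding limitin_weak_topology
proof (intro allI impI)
  fix f :: "'a \<times> 'b \<Rightarrow> real"
  assume f: "linear f" and "\<exists>K. \<forall>p. \<bar>f p\<bar> \<le> K * max_norm p"
  then obtain K where K: "\<And>p. \<bar>f p\<bar> \<le> K * max_norm p" by blast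
  have l1: "bounded_linear (\<lambda>u. f (u, 0))"
  proof (rule bounded_linear_intro[where K = K])
    show "f (u + v, 0) = f (u, 0) + f (v, 0)" for u v
      using linear_add[OF f, of "(u, 0)" "(v, 0)"] by simp
    show "f (c *\<^sub>R u, 0) = c *\<^sub>R f (u, 0)" for c u
      using linear_scale[OF f, of c "(u, 0)"] by simp
    show "norm (f (u, 0)) \<le> norm u * K" for u
      using K[of "(u, 0)"] by (simp add: max_norm_def mult.commute)
  qed
  have l2: "bounded_linear (\<lambda>v. f (0, v))"
  proof (rule bounded_linear_intro[where K = K])
    show "f (0, u + v) = f (0, u) + f (0, v)" for u v
      using linear_add[OF f, of "(0, u)" "(0, v)"] by simp
    show "f (0, c *\<^sub>R u) = c *\<^sub>R f (0, u)" for c u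
      using linear_scale[OF f, of c "(0, u)"] by simp
    show "norm (f (0, v)) \<le> norm v * K" for v
      using K[of "(0, v)"] by (simp add: max_norm_def mult.commute)
  qed
  have split: "f (u, v) = f (u, 0) + f (0, v)" for u v
    using linear_add[OF f, of "(u, 0)" "(0, v)"] by simp
  have "((\<lambda>i. f (x i, 0) + f (0, y i)) \<longlongrightarrow> f (a, 0) + f (0, b)) F"
    using x[of "Blinfun (\<lambda>u. f (u, 0))"] y[of "Blinfun (\<lambda>v. f (0, v))"]
    by (intro tendsto_add) (simp_all add: bounded_linear_Blinfun_apply l1 l2)
  then show "((\<lambda>i. f (x i, y i)) \<longlongrightarrow> f (a, b)) F" by (simp flip: split)
qed

text \<open>
  Evaluation at the points \<open>x i\<close> is a net in a product of compact intervals indexed by the dual.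
  A cluster point of it is a bounded functional on the dual, which by reflexivity is evaluation
  at a point of the space.
\<close>

lemma reflexive_unit_ball_weakly_compact:
  fixes x :: "'i \<Rightarrow> 'a::real_normed_vector"
  assumes refl: "reflexive_space TYPE('a)" and F: "F \<noteq> bot" and x: "\<And>i. norm (x i) \<le> 1"
  obtains l G where "G \<le> F" "G \<noteq> bot" "norm l \<le> 1"
    "\<And>f :: 'a \<Rightarrow>\<^sub>L real. ((\<lambda>i. blinfun_apply f (x i)) \<longlongrightarrow> blinfun_apply f l) G"
proof -
  define e where "e i = (\<lambda>f :: 'a \<Rightarrow>\<^sub>L real. blinfun_apply f (x i))" for i
  let ?K = "PiE UNIV (\<lambda>f :: 'a \<Rightarrow>\<^sub>L real. {- norm f..norm f})"
  have "compactin (product_topology (\<lambda>_. euclidean) UNIV) ?K"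
    by (subst compactin_PiE) auto
  then have comp: "compact ?K" by (simp add: euclidean_product_topology)
  have eK: "e i \<in> ?K" for i
  proof -
    have "\<bar>blinfun_apply f (x i)\<bar> \<le> norm f" for f :: "'a \<Rightarrow>\<^sub>L real"
      using norm_blinfun[of f "x i"] mult_left_mono[OF x[of i] norm_ge_zero[of f]] by simp
    then show ?thesis by (auto simp: e_def abs_le_iff minus_le_iff)
  qed
  have "\<forall>\<^sub>F g in filtermap e F. g \<in> ?K"
    using eK unfolding eventually_filtermap by (intro always_eventually allI)
  moreover have "filtermap e F \<noteq> bot" using F by (simp add: filtermap_bot_iff)
  ultimately obtain \<phi> where \<phi>K: "\<phi> \<in> ?K" and \<phi>: "inf (nhds \<phi>) (filtermap e F) \<noteq> bot"
    using comp[unfolded compact_filter, rule_format, of "filtermap e F"] by blast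
  define G where "G = inf F (filtercomap e (nhds \<phi>))"
  have "G \<noteq> bot"
  proof
    assume "G = bot"
    then obtain P Q where P: "eventually P F" and Q: "eventually Q (nhds \<phi>)"
      and PQ: "\<And>i. P i \<Longrightarrow> \<not> Q (e i)"
      unfolding G_def trivial_limit_def eventually_inf eventually_filtercomap by blast
    have "\<forall>\<^sub>F g in filtermap e F. \<not> Q g"
      using P PQ by (auto simp: eventually_filtermap elim: eventually_mono)
    then have "inf (nhds \<phi>) (filtermap e F) = bot"
      using Q unfolding trivial_limit_def eventually_inf by blast
    with \<phi> show False ..
  qed
  have "filterlim e (nhds \<phi>) G"
    unfolding G_def by (rule filterlim_mono[OF filterlim_filtercomap order_refl]) simp
  then have conv: "((\<lambda>i. blinfun_apply f (x i)) \<longlongrightarrow> \<phi> f) G" for f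
    using continuous_on_tendsto_compose[OF continuous_on_product_coordinates[of f]]
    unfolding e_def by fastforce
  have "bounded_linear \<phi>"
  proof (rule bounded_linear_intro[where K = 1])
    fix f g
    show "\<phi> (f + g) = \<phi> f + \<phi> g"
      using tendsto_unique[OF \<open>G \<noteq> bot\<close> conv[of "f + g"]] tendsto_add[OF conv[of f] conv[of g]]
      by (simp add: blinfun.add_left)
  next
    fix c f
    show "\<phi> (c *\<^sub>R f) = c *\<^sub>R \<phi> f"
      using tendsto_unique[OF \<open>G \<noteq> bot\<close> conv[of "c *\<^sub>R f"]] tendsto_scaleR[OF tendsto_const conv[of f]]
      by (simp add: blinfun.scaleR_left)
  next
    fix f
    have "\<phi> f \<in> {- norm f..norm f}" using \<phi>K by auto
    then show "norm (\<phi> f) \<le> norm f * 1" by auto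
  qed
  then obtain l where l: "\<And>f. \<phi> f = blinfun_apply f l"
    using refl unfolding reflexive_space_def by (metis bounded_linear_Blinfun_apply)
  obtain f :: "'a \<Rightarrow>\<^sub>L real" where f: "blinfun_apply f l = norm l" "\<And>u. \<bar>blinfun_apply f u\<bar> \<le> norm u"
    using norming_functional by blast
  have "\<forall>\<^sub>F i in G. blinfun_apply f (x i) \<le> 1"
    using f(2) x by (intro always_eventually allI) (meson abs_le_D1 order_trans)
  then have "norm l \<le> 1"
    using tendsto_upperbound[OF conv[of f]] \<open>G \<noteq> bot\<close> l f(1) by simp
  moreover have "G \<le> F" by (simp add: G_def)
  ultimately show thesis
    using that[of G l] \<open>G \<noteq> bot\<close> conv[unfolded l] by blast
qed

text \<open>
  A norm limit of values must be the value at the weak limit of the arguments, since both have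
  the same image under every bounded functional.
\<close>

lemma weak_weak_continuous_limit:
  fixes T :: "'a::real_normed_vector \<Rightarrow> 'b::real_normed_vector \<Rightarrow> 'c::real_normed_vector"
  assumes T: "weak_weak_continuous T" and G: "G \<noteq> bot"
    and x: "\<And>f :: 'a \<Rightarrow>\<^sub>L real. ((\<lambda>i. blinfun_apply f (x i)) \<longlongrightarrow> blinfun_apply f a) G"
    and y: "\<And>f :: 'b \<Rightarrow>\<^sub>L real. ((\<lambda>i. blinfun_apply f (y i)) \<longlongrightarrow> blinfun_apply f b) G"
    and z: "((\<lambda>i. T (x i) (y i)) \<longlongrightarrow> z) G"
  shows "z = T a b"
proof -
  have lim: "limitin (weak_topology norm) (\<lambda>i. T (x i) (y i)) (T a b) G"
    using continuous_map_limit[OF T[unfolded weak_weak_continuous_def]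
        limitin_weak_topology_max_norm[OF x y]] by (simp add: o_def)
  obtain f :: "'c \<Rightarrow>\<^sub>L real" where f: "blinfun_apply f (z - T a b) = norm (z - T a b)"
      "\<And>u. \<bar>blinfun_apply f u\<bar> \<le> norm u"
    using norming_functional by blast
  have "linear (blinfun_apply f)"
    by (rule bounded_linear.linear[OF blinfun.bounded_linear_right])
  moreover have "\<exists>K. \<forall>u. \<bar>blinfun_apply f u\<bar> \<le> K * norm u" using f(2) by (auto intro: exI[of _ 1])
  ultimately have "((\<lambda>i. blinfun_apply f (T (x i) (y i))) \<longlongrightarrow> blinfun_apply f (T a b)) G"
    using lim unfolding limitin_weak_topology by blast
  moreover have "((\<lambda>i. blinfun_apply f (T (x i) (y i))) \<longlongrightarrow> blinfun_apply f z) G"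
    using z by (rule bounded_linear.tendsto[OF blinfun.bounded_linear_right])
  ultimately have "blinfun_apply f z = blinfun_apply f (T a b)"
    using tendsto_unique[OF G] by blast
  then show ?thesis using f(1) by (simp add: blinfun.diff_right)
qed

text \<open>
  The subsequence is chosen by norm convergence of the values. The weak cluster point of the
  arguments is then taken along a finer filter, first in one factor and then in the other.
\<close>

lemma compact_pair_subsequence:
  fixes T A :: "'a::real_normed_vector \<Rightarrow> 'b::real_normed_vector \<Rightarrow> 'c::real_normed_vector"
  assumes "reflexive_space TYPE('a)" "reflexive_space TYPE('b)"
    and T: "compact_bilinear T" "weak_weak_continuous T"
    and A: "compact_bilinear A" "weak_weak_continuous A"
    and x: "\<And>n. norm (x n) \<le> 1" and y: "\<And>n. norm (y n) \<le> 1"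
  obtains a b and r :: "nat \<Rightarrow> nat" where "strict_mono r" "norm a \<le> 1" "norm b \<le> 1"
    "(\<lambda>n. T (x (r n)) (y (r n))) \<longlonglongrightarrow> T a b" "(\<lambda>n. A (x (r n)) (y (r n))) \<longlonglongrightarrow> A a b"
proof -
  have "\<exists>B. \<forall>n. max_norm (x n, y n) \<le> B"
    using x y by (auto simp: max_norm_def)
  then obtain z r where r: "strict_mono r" and z: "(\<lambda>n. T (x (r n)) (y (r n))) \<longlonglongrightarrow> z"
    using T(1)[unfolded compact_bilinear_def, THEN conjunct2, rule_format, of "\<lambda>n. (x n, y n)"] by auto
  have "\<exists>B. \<forall>n. max_norm (x (r n), y (r n)) \<le> B"
    using x y by (auto simp: max_norm_def)
  then obtain w s where s: "strict_mono s" and w: "(\<lambda>n. A (x (r (s n))) (y (r (s n)))) \<longlonglongrightarrow> w"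
    using A(1)[unfolded compact_bilinear_def, THEN conjunct2, rule_format, of "\<lambda>n. (x (r n), y (r n))"]
    by auto
  have z': "(\<lambda>n. T (x (r (s n))) (y (r (s n)))) \<longlonglongrightarrow> z"
    using LIMSEQ_subseq_LIMSEQ[OF z s] by (simp add: o_def)
  obtain a G where G: "G \<le> sequentially" "G \<noteq> bot" and a: "norm a \<le> 1"
    and ax: "\<And>f :: 'a \<Rightarrow>\<^sub>L real. ((\<lambda>n. blinfun_apply f (x (r (s n)))) \<longlongrightarrow> blinfun_apply f a) G"
    by (rule reflexive_unit_ball_weakly_compact[OF assms(1) sequentially_bot, of "\<lambda>n. x (r (s n))", OF x]) (rule that; blast)
  obtain b H where H: "H \<le> G" "H \<noteq> bot" and b: "norm b \<le> 1"
    and by': "\<And>f :: 'b \<Rightarrow>\<^sub>L real. ((\<lambda>n. blinfun_apply f (y (r (s n)))) \<longlongrightarrow> blinfun_apply f b) H"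
    by (rule reflexive_unit_ball_weakly_compact[OF assms(2) G(2), of "\<lambda>n. y (r (s n))", OF y]) (rule that; blast)
  have HS: "H \<le> sequentially" using H G by simp
  note ax' = tendsto_mono[OF H(1) ax]
  have "z = T a b"
    by (rule weak_weak_continuous_limit[OF T(2) H(2) ax' by' tendsto_mono[OF HS z']])
  moreover have "w = A a b"
    by (rule weak_weak_continuous_limit[OF A(2) H(2) ax' by' tendsto_mono[OF HS w]])
  ultimately show thesis
    using a b z' w strict_mono_o[OF r s] by (intro that[of "r \<circ> s"]) auto
qed

section \<open>The norm of a bilinear operator\<close>

lemma compact_bilinear_bounded:
  assumes "compact_bilinear T"
  obtains B where "\<And>x y. norm x = 1 \<Longrightarrow> norm y = 1 \<Longrightarrow> norm (T x y) \<le> B"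
proof (rule ccontr)
  assume "\<not> thesis"
  then have "\<exists>p. norm (fst p) = 1 \<and> norm (snd p) = 1 \<and> norm (T (fst p) (snd p)) > real n" for n
    using that by (metis fst_conv linorder_not_less snd_conv)
  then obtain p where p: "\<And>n. norm (fst (p n)) = 1" "\<And>n. norm (snd (p n)) = 1"
      "\<And>n. norm (T (fst (p n)) (snd (p n))) > real n"
    by metis
  have "\<exists>B. \<forall>n. max_norm (p n) \<le> B" using p by (auto simp: max_norm_def)
  then obtain l r where r: "strict_mono (r :: nat \<Rightarrow> nat)"
    and l: "(\<lambda>n. T (fst (p (r n))) (snd (p (r n)))) \<longlonglongrightarrow> l"
    using assms unfolding compact_bilinear_def by blast
  obtain K where K: "\<And>n. norm (T (fst (p (r n))) (snd (p (r n)))) \<le> K"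
    using convergent_imp_Bseq[OF convergentI[OF l]] by (auto simp: Bseq_def)
  obtain n where "K < real n" using reals_Archimedean2 by blast
  moreover have "real n \<le> real (r n)" using seq_suble[OF r] by simp
  ultimately show False using K[of n] p(3)[of "r n"] by linarith
qed

lemma bilin_norm_upper:
  assumes "\<And>x y. norm x = 1 \<Longrightarrow> norm y = 1 \<Longrightarrow> norm (T x y) \<le> B" and "norm x = 1" "norm y = 1"
  shows "norm (T x y) \<le> bilin_norm T"
proof -
  have "bdd_above ((\<lambda>(x, y). norm (T x y)) ` (sphere 0 1 \<times> sphere 0 1))"
    using assms(1) by (intro bdd_aboveI2[where M = B]) auto
  then show ?thesis
    unfolding bilin_norm_def
    using assms(2,3) cSUP_upper[of "(x, y)" "sphere 0 1 \<times> sphere 0 1" "\<lambda>(x, y). norm (T x y)"]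
    by simp
qed

lemma near_maximiser_exists:
  fixes T :: "'a::real_normed_vector \<Rightarrow> 'b::real_normed_vector \<Rightarrow> 'c::real_normed_vector"
  assumes "(e :: 'a) \<noteq> 0" "(g :: 'b) \<noteq> 0"
    and T: "\<And>x y. norm x = 1 \<Longrightarrow> norm y = 1 \<Longrightarrow> norm (T x y) \<le> B" and "c < bilin_norm T"
  obtains x y where "norm x = 1" "norm y = 1" "c < norm (T x y)"
proof -
  have "sgn e \<in> sphere 0 1" "sgn g \<in> sphere 0 1" using assms by (auto simp: norm_sgn)
  moreover have "bdd_above ((\<lambda>(x, y). norm (T x y)) ` (sphere 0 1 \<times> sphere 0 1))"
    using T by (intro bdd_aboveI2[where M = B]) auto
  ultimately have "\<exists>p \<in> sphere 0 1 \<times> sphere 0 1. c < (\<lambda>(x, y). norm (T x y)) p"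
    using assms(4) unfolding bilin_norm_def by (subst (asm) less_cSUP_iff) auto
  then show thesis using that by auto
qed

lemma bilinear_norm_le:
  assumes T: "compact_bilinear T"
  shows "norm (T x y) \<le> bilin_norm T * (norm x * norm y)"
proof (cases "x = 0 \<or> y = 0")
  case True
  then show ?thesis
    using T by (auto simp: compact_bilinear_def bilinear_lzero bilinear_rzero)
next
  case False
  have bil: "bilinear T" using T by (simp add: compact_bilinear_def)
  obtain B where B: "\<And>x y. norm x = 1 \<Longrightarrow> norm y = 1 \<Longrightarrow> norm (T x y) \<le> B"
    using compact_bilinear_bounded[OF T] by blast
  have "T x y = (norm x * norm y) *\<^sub>R T (sgn x) (sgn y)"
    using False by (simp add: sgn_div_norm bilinear_lmul[OF bil] bilinear_rmul[OF bil] field_simps)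
  moreover have "norm (T (sgn x) (sgn y)) \<le> bilin_norm T"
    using False by (intro bilin_norm_upper[OF B]) (auto simp: norm_sgn)
  then have "(norm x * norm y) * norm (T (sgn x) (sgn y)) \<le> (norm x * norm y) * bilin_norm T"
    by (intro mult_left_mono) auto
  with calculation show ?thesis by (simp add: mult.commute)
qed

lemma bilin_norm_nonneg:
  assumes "compact_bilinear (T :: 'a::real_normed_vector \<Rightarrow> 'b::real_normed_vector \<Rightarrow> 'c::real_normed_vector)"
    and "(e :: 'a) \<noteq> 0" "(g :: 'b) \<noteq> 0"
  shows "0 \<le> bilin_norm T"
proof -
  have "norm (T (sgn e) (sgn g)) \<le> bilin_norm T"
    using bilinear_norm_le[OF assms(1), of "sgn e" "sgn g"] assms by (simp add: norm_sgn)
  then show ?thesis using norm_ge_zero order_trans by blast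
qed

lemma pencil_bounded:
  assumes "compact_bilinear T" "compact_bilinear A"
  obtains B where "\<And>x y. norm x = 1 \<Longrightarrow> norm y = 1 \<Longrightarrow> norm (T x y + t *\<^sub>R A x y) \<le> B"
proof -
  obtain B1 B2 where B: "\<And>x y. norm x = 1 \<Longrightarrow> norm y = 1 \<Longrightarrow> norm (T x y) \<le> B1"
      "\<And>x y. norm x = 1 \<Longrightarrow> norm y = 1 \<Longrightarrow> norm (A x y) \<le> B2"
    using compact_bilinear_bounded assms by metis
  have "norm (T x y + t *\<^sub>R A x y) \<le> B1 + \<bar>t\<bar> * B2" if "norm x = 1" "norm y = 1" for x y
    using norm_triangle_ineq[of "T x y" "t *\<^sub>R A x y"] B(1)[OF that]
      mult_left_mono[OF B(2)[OF that] abs_ge_zero[of t]] by simp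
  then show thesis by (rule that)
qed

section \<open>Orthogonality\<close>

text \<open>
  Convexity of \<open>t \<mapsto> \<parallel>a + t b\<parallel>\<close>: its graph starts on or below the line \<open>t \<mapsto> N - h t\<close>
  and lies above that line at \<open>t = h\<close>, hence also at all later \<open>t\<close>.
\<close>

lemma norm_pencil_convex:
  fixes a b :: "'a::real_normed_vector"
  assumes "norm a \<le> N" "N - h\<^sup>2 < norm (a + h *\<^sub>R b)" "0 < h" "h \<le> t"
  shows "N - h * t < norm (a + t *\<^sub>R b)"
proof -
  define s where "s = h / t"
  have t: "t > 0" and s: "0 < s" "s \<le> 1" and st: "s * t = h"
    using assms by (auto simp: s_def)
  have "a + h *\<^sub>R b = (1 - s) *\<^sub>R a + s *\<^sub>R (a + t *\<^sub>R b)"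
    by (simp add: algebra_simps st)
  then have "norm (a + h *\<^sub>R b) \<le> (1 - s) * norm a + s * norm (a + t *\<^sub>R b)"
    using norm_triangle_ineq[of "(1 - s) *\<^sub>R a" "s *\<^sub>R (a + t *\<^sub>R b)"] s by simp
  also have "(1 - s) * norm a \<le> (1 - s) * N"
    using s assms by (intro mult_left_mono) auto
  finally have "s * (N - h * t) < s * norm (a + t *\<^sub>R b)"
    using assms(2) by (simp add: algebra_simps power2_eq_square flip: st)
  then show ?thesis using s by simp
qed

text \<open>
  The hypothesis \<open>sub\<close> is the conclusion of \<open>compact_pair_subsequence\<close>. In this form it passes from
  \<open>A\<close> to \<open>- A\<close>.
\<close>

lemma one_sided_orthogonality_attained:
  fixes T A :: "'a::real_normed_vector \<Rightarrow> 'b::real_normed_vector \<Rightarrow> 'c::real_normed_vector"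
  assumes nz: "(e :: 'a) \<noteq> 0" "(g :: 'b) \<noteq> 0" and T: "compact_bilinear T"
    and bdd: "\<And>t. \<exists>B. \<forall>x y. norm x = 1 \<longrightarrow> norm y = 1 \<longrightarrow> norm (T x y + t *\<^sub>R A x y) \<le> B"
    and sub: "\<And>x y. (\<And>n. norm (x n) \<le> 1) \<Longrightarrow> (\<And>n. norm (y n) \<le> 1) \<Longrightarrow>
      \<exists>a b r. strict_mono (r :: nat \<Rightarrow> nat) \<and> norm a \<le> 1 \<and> norm b \<le> 1 \<and>
        (\<lambda>n. T (x (r n)) (y (r n))) \<longlonglongrightarrow> T a b \<and> (\<lambda>n. A (x (r n)) (y (r n))) \<longlonglongrightarrow> A a b"
    and orth: "\<And>t. t \<ge> 0 \<Longrightarrow> bilin_norm (\<lambda>x y. T x y + t *\<^sub>R A x y) \<ge> bilin_norm T"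
  shows "\<exists>x y. (x, y) \<in> norm_attainment T \<and> A x y \<in> bj_plus (T x y)"
proof (cases "bilin_norm T = 0")
  case True
  \<comment> \<open>Every vector belongs to \<open>bj_plus 0\<close>, so any pair of unit vectors will do.\<close>
  have "T x y = 0" for x y
    using bilinear_norm_le[OF T, of x y] True by simp
  then have "(sgn e, sgn g) \<in> norm_attainment T" "A (sgn e) (sgn g) \<in> bj_plus (T (sgn e) (sgn g))"
    using nz True by (auto simp: norm_attainment_def bj_plus_def norm_sgn)
  then show ?thesis by blast
next
  case False
  define N where "N = bilin_norm T"
  have "N > 0" using False bilin_norm_nonneg[OF T nz] by (simp add: N_def)
  define h where "h n = 1 / real (Suc n)" for n
  have h: "h n > 0" for n by (simp add: h_def)
  have h0: "h \<longlonglongrightarrow> 0" unfolding h_def by (rule LIMSEQ_Suc[OF lim_1_over_n])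
  have "\<exists>x y. norm x = 1 \<and> norm y = 1 \<and> N - (h n)\<^sup>2 < norm (T x y + h n *\<^sub>R A x y)" for n
  proof -
    have "N - (h n)\<^sup>2 < bilin_norm (\<lambda>x y. T x y + h n *\<^sub>R A x y)"
      using orth[of "h n"] h[of n] zero_less_power[OF h, of n 2] unfolding N_def by linarith
    moreover obtain B where "\<And>x y. norm x = 1 \<Longrightarrow> norm y = 1 \<Longrightarrow> norm (T x y + h n *\<^sub>R A x y) \<le> B"
      using bdd[of "h n"] by blast
    ultimately obtain x y where "norm x = 1" "norm y = 1" "N - (h n)\<^sup>2 < norm (T x y + h n *\<^sub>R A x y)"
      using near_maximiser_exists[OF nz, of "\<lambda>x y. T x y + h n *\<^sub>R A x y" B "N - (h n)\<^sup>2"] by blast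
    then show ?thesis by blast
  qed
  then obtain x y where x: "\<And>n. norm (x n) = 1" and y: "\<And>n. norm (y n) = 1"
    and near: "\<And>n. N - (h n)\<^sup>2 < norm (T (x n) (y n) + h n *\<^sub>R A (x n) (y n))"
    by metis
  obtain a b r where r: "strict_mono (r :: nat \<Rightarrow> nat)" and ab: "norm a \<le> 1" "norm b \<le> 1"
    and Tl: "(\<lambda>n. T (x (r n)) (y (r n))) \<longlonglongrightarrow> T a b" and Al: "(\<lambda>n. A (x (r n)) (y (r n))) \<longlonglongrightarrow> A a b"
    using sub[of x y] x y by auto
  have hr: "(\<lambda>n. h (r n)) \<longlonglongrightarrow> 0"
    using LIMSEQ_subseq_LIMSEQ[OF h0 r] by (simp add: o_def)
  have le: "norm (T (x n) (y n)) \<le> N" for n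
    using bilinear_norm_le[OF T, of "x n" "y n"] x y by (simp add: N_def)
  have pos: "N \<le> norm (T a b + t *\<^sub>R A a b)" if "t > 0" for t
  proof (rule LIMSEQ_le)
    show "(\<lambda>n. N - h (r n) * t) \<longlonglongrightarrow> N"
      using tendsto_diff[OF tendsto_const[of N] tendsto_mult_right[OF hr, of t]] by simp
    show "(\<lambda>n. norm (T (x (r n)) (y (r n)) + t *\<^sub>R A (x (r n)) (y (r n)))) \<longlonglongrightarrow> norm (T a b + t *\<^sub>R A a b)"
      by (intro tendsto_intros Tl Al)
    have "\<forall>\<^sub>F n in sequentially. h (r n) < t"
      using order_tendstoD(2)[OF hr that] .
    then have "\<forall>\<^sub>F n in sequentially. N - h (r n) * t \<le> norm (T (x (r n)) (y (r n)) + t *\<^sub>R A (x (r n)) (y (r n)))"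
      by eventually_elim (intro less_imp_le norm_pencil_convex le near h)
    then show "\<exists>M. \<forall>n\<ge>M. N - h (r n) * t \<le> norm (T (x (r n)) (y (r n)) + t *\<^sub>R A (x (r n)) (y (r n)))"
      by (simp add: eventually_sequentially)
  qed
  \<comment> \<open>The case \<open>t = 0\<close>, by continuity in \<open>t\<close>.\<close>
  have lower: "N \<le> norm (T a b)"
  proof (rule LIMSEQ_le_const)
    show "(\<lambda>n. norm (T a b + h n *\<^sub>R A a b)) \<longlonglongrightarrow> norm (T a b)"
      using tendsto_norm[OF tendsto_add[OF tendsto_const[of "T a b"] tendsto_scaleR[OF h0 tendsto_const[of "A a b"]]]]
      by simp
  qed (use pos h in auto)
  \<comment> \<open>A value of norm at least \<open>N > 0\<close> cannot occur strictly inside either unit ball.\<close>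
  have "N * 1 \<le> N * (norm a * norm b)"
    using lower bilinear_norm_le[OF T, of a b] by (simp add: N_def)
  then have prod: "1 \<le> norm a * norm b"
    using \<open>N > 0\<close> mult_le_cancel_left_pos by blast
  have "norm a * norm b \<le> norm a" "norm a * norm b \<le> norm b"
    using ab by (simp_all add: mult_left_le mult_left_le_one_le)
  with prod ab have unit: "norm a = 1" "norm b = 1" by linarith+
  then have "norm (T a b) = N"
    using lower bilinear_norm_le[OF T, of a b] by (simp add: N_def)
  moreover have "N \<le> norm (T a b + t *\<^sub>R A a b)" if "t \<ge> 0" for t
    using pos[of t] lower that by (cases "t = 0") auto
  ultimately have "(a, b) \<in> norm_attainment T" "A a b \<in> bj_plus (T a b)"
    using unit by (auto simp: norm_attainment_def bj_plus_def N_def)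
  then show ?thesis by blast
qed

lemma bj_minus_iff_bj_plus: "y \<in> bj_minus x \<longleftrightarrow> - y \<in> bj_plus x"
proof -
  have "(\<forall>t\<le>0. norm x \<le> norm (x + t *\<^sub>R y)) \<longleftrightarrow> (\<forall>t\<ge>0. norm x \<le> norm (x + (- t) *\<^sub>R y))"
    by (metis minus_minus neg_0_le_iff_le)
  then show ?thesis by (simp add: bj_minus_def bj_plus_def)
qed

theorem theorem3p1:
  fixes T A :: "'a::banach \<Rightarrow> 'b::banach \<Rightarrow> 'c::real_normed_vector"
  assumes "reflexive_space TYPE('a)" and "reflexive_space TYPE('b)"
    and "dim_gt_one TYPE('a)" and "dim_gt_one TYPE('b)" and "dim_gt_one TYPE('c)"
    and "compact_bilinear T" and "weak_weak_continuous T"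
    and "compact_bilinear A" and "weak_weak_continuous A"
  shows "bj_orthogonal T A \<longleftrightarrow>
    (\<exists>x y u v. (x, y) \<in> norm_attainment T \<and> (u, v) \<in> norm_attainment T \<and>
       A x y \<in> bj_plus (T x y) \<and> A u v \<in> bj_minus (T u v))"
proof
  assume orth: "bj_orthogonal T A"
  obtain e :: 'a and g :: 'b where nz: "e \<noteq> 0" "g \<noteq> 0"
  proof -
    obtain e e' :: 'a where e: "independent {e, e'}"
      using assms(3) by (auto simp: dim_gt_one_def)
    obtain g g' :: 'b where g: "independent {g, g'}"
      using assms(4) by (auto simp: dim_gt_one_def)
    have "e \<noteq> 0" "g \<noteq> 0"
      using e g dependent_zero[of "{e, e'}"] dependent_zero[of "{g, g'}"] by auto
    then show thesis by (rule that)
  qed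
  have bdd: "\<exists>B. \<forall>x y. norm x = 1 \<longrightarrow> norm y = 1 \<longrightarrow> norm (T x y + t *\<^sub>R A x y) \<le> B" for t
    by (rule pencil_bounded[OF assms(6,8), of t]) blast
  have sub: "\<exists>a b r. strict_mono (r :: nat \<Rightarrow> nat) \<and> norm a \<le> 1 \<and> norm b \<le> 1 \<and>
        (\<lambda>n. T (x (r n)) (y (r n))) \<longlonglongrightarrow> T a b \<and> (\<lambda>n. A (x (r n)) (y (r n))) \<longlonglongrightarrow> A a b"
    if "\<And>n. norm (x n) \<le> 1" "\<And>n. norm (y n) \<le> 1" for x y
    by (rule compact_pair_subsequence[OF assms(1,2,6-9), of x y, OF that]) blast
  have "\<exists>x y. (x, y) \<in> norm_attainment T \<and> A x y \<in> bj_plus (T x y)"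
    using orth unfolding bj_orthogonal_def
    by (intro one_sided_orthogonality_attained[OF nz assms(6) bdd sub]) blast+
  moreover have "\<exists>u v. (u, v) \<in> norm_attainment T \<and> - A u v \<in> bj_plus (T u v)"
  proof (rule one_sided_orthogonality_attained[OF nz assms(6)])
    show "\<exists>B. \<forall>x y. norm x = 1 \<longrightarrow> norm y = 1 \<longrightarrow> norm (T x y + t *\<^sub>R - A x y) \<le> B" for t
      using bdd[of "- t"] by simp
    show "bilin_norm T \<le> bilin_norm (\<lambda>x y. T x y + t *\<^sub>R - A x y)" for t
      using orth[unfolded bj_orthogonal_def, rule_format, of "- t"] by simp
    show "\<exists>a b r. strict_mono (r :: nat \<Rightarrow> nat) \<and> norm a \<le> 1 \<and> norm b \<le> 1 \<and>
        (\<lambda>n. T (x (r n)) (y (r n))) \<longlonglongrightarrow> T a b \<and> (\<lambda>n. - A (x (r n)) (y (r n))) \<longlonglongrightarrow> - A a b"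
      if xy: "\<And>n. norm (x n) \<le> 1" "\<And>n. norm (y n) \<le> 1" for x y
    proof -
      obtain a b r where "strict_mono (r :: nat \<Rightarrow> nat)" "norm a \<le> 1" "norm b \<le> 1"
        "(\<lambda>n. T (x (r n)) (y (r n))) \<longlonglongrightarrow> T a b" "(\<lambda>n. A (x (r n)) (y (r n))) \<longlonglongrightarrow> A a b"
        using sub[of x y, OF xy] by blast
      moreover from this(5) have "(\<lambda>n. - A (x (r n)) (y (r n))) \<longlonglongrightarrow> - A a b"
        by (rule tendsto_minus)
      ultimately show ?thesis by blast
    qed
  qed
  ultimately show "\<exists>x y u v. (x, y) \<in> norm_attainment T \<and> (u, v) \<in> norm_attainment T \<and>
       A x y \<in> bj_plus (T x y) \<and> A u v \<in> bj_minus (T u v)"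
    unfolding bj_minus_iff_bj_plus by blast
next
  assume "\<exists>x y u v. (x, y) \<in> norm_attainment T \<and> (u, v) \<in> norm_attainment T \<and>
       A x y \<in> bj_plus (T x y) \<and> A u v \<in> bj_minus (T u v)"
  then obtain x y u v where xy: "(x, y) \<in> norm_attainment T" "A x y \<in> bj_plus (T x y)"
    and uv: "(u, v) \<in> norm_attainment T" "A u v \<in> bj_minus (T u v)" by blast
  have lower: "bilin_norm T \<le> bilin_norm (\<lambda>x y. T x y + t *\<^sub>R A x y)"
    if "(x, y) \<in> norm_attainment T" "norm (T x y) \<le> norm (T x y + t *\<^sub>R A x y)" for t x y
  proof -
    obtain B where B: "\<And>x y. norm x = 1 \<Longrightarrow> norm y = 1 \<Longrightarrow> norm (T x y + t *\<^sub>R A x y) \<le> B"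
      using pencil_bounded[OF assms(6,8), of t] by blast
    have "norm x = 1" "norm y = 1" "norm (T x y) = bilin_norm T"
      using that(1) by (auto simp: norm_attainment_def)
    then show ?thesis
      using bilin_norm_upper[of "\<lambda>x y. T x y + t *\<^sub>R A x y" B x y] B that(2) by simp
  qed
  show "bj_orthogonal T A"
    unfolding bj_orthogonal_def
  proof
    fix t :: real
    show "bilin_norm T \<le> bilin_norm (\<lambda>x y. T x y + t *\<^sub>R A x y)"
      using lower[OF xy(1), of t] lower[OF uv(1), of t] xy(2) uv(2)
      by (cases "t \<ge> 0") (auto simp: bj_plus_def bj_minus_def)
  qed
qed

end
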